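(* The existence of a finite second symmetric Borel derivative $SBD^{2}f(x_0)$ of a locally integrable function $f$ does not, in general, imply that $T_f''$ has a (full) Łojasiewicz distributional point value at $x_0$. Indeed, for $f(x)=x_+^2$, where $x_+=\max\{x,0\}$, one has \[ SBD^{1}f(0)=0, \qquad SBD^{2}f(0)=1, \] but $T_f''=2H$ (the regular distribution given by $2H$, with $H$ the Heaviside function) has no Łojasiewicz distributional point value at $0$.
   Context: $\mathcal{D}(\mathbb{R})=C_c^\infty(\mathbb{R})$. For $f\in L^1_{\mathrm{loc}}(\mathbb{R})$, $T_f$ is the regular distribution $\langle T_f,\psi\rangle=\int_{\mathbb{R}} f\psi\,dx$, and $\langle T_f'',\psi\rangle=\langle T_f,\psi''\rangle$ for $\psi\in\mathcal{D}(\mathbb{R})$. For $\phi\in\mathcal{D}(\mathbb{R})$ and $\varepsilon>0$, $\phi_{x_0,\varepsilon}(x)=\varepsilon^{-1}\phi\left(\frac{x-x_0}{\varepsilon}\right)$. A distribution $T$ has the Łojasiewicz distributional point value $L\in\mathbb{R}$ at $x_0$ if $\lim_{\varepsilon\to 0^+}\langle T,\phi_{x_0,\varepsilon}\rangle=L\int_{\mathbb{R}}\phi(u)\,du$ for every $\phi\in\mathcal{D}(\mathbb{R})$. The first and second symmetric Borel derivatives of $f$ at $x_0$ are, whenever the limits exist finitely, \[ SBD^{1}f(x_0)=\lim_{h\to 0^+}\frac{1}{h}\int_0^h \frac{f(x_0+t)-f(x_0-t)}{2t}\,dt, \qquad SBD^{2}f(x_0)=\lim_{h\to 0^+}\frac{1}{h}\int_0^h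 \frac{f(x_0+t)+f(x_0-t)-2f(x_0)}{t^2}\,dt. \] *)

theory Defs
  imports "HOL-Analysis.Analysis"
begin

definition test_functions :: "(real \<Rightarrow> real) set" where
  "test_functions =
     {\<psi>. (\<forall>n. (deriv ^^ n) \<psi> differentiable_on UNIV) \<and> compact (closure {x. \<psi> x \<noteq> 0})}"

definition locally_integrable :: "(real \<Rightarrow> real) \<Rightarrow> bool" where
  "locally_integrable f \<longleftrightarrow> (\<forall>K. compact K \<longrightarrow> f absolutely_integrable_on K)"

text \<open>
  Distributions are rendered as functionals on \<^typ>\<open>real \<Rightarrow> real\<close>, of which only the values on
  \<^const>\<open>test_functions\<close> are meaningful. In particular, equality of distributions is agreement
  on \<^const>\<open>test_functions\<close>, not equality of the underlying HOL functions.
\<close>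

definition regular_distribution :: "(real \<Rightarrow> real) \<Rightarrow> (real \<Rightarrow> real) \<Rightarrow> real" where
  "regular_distribution f \<psi> = (LINT x|lebesgue. f x * \<psi> x)"

definition distribution_deriv2 :: "((real \<Rightarrow> real) \<Rightarrow> real) \<Rightarrow> (real \<Rightarrow> real) \<Rightarrow> real" where
  "distribution_deriv2 T \<psi> = T (deriv (deriv \<psi>))"

definition distribution_eq ::
    "((real \<Rightarrow> real) \<Rightarrow> real) \<Rightarrow> ((real \<Rightarrow> real) \<Rightarrow> real) \<Rightarrow> bool" where
  "distribution_eq S T \<longleftrightarrow> (\<forall>\<psi>\<in>test_functions. S \<psi> = T \<psi>)"

definition rescaled :: "(real \<Rightarrow> real) \<Rightarrow> real \<Rightarrow> real \<Rightarrow> real \<Rightarrow> real" where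
  "rescaled \<phi> x0 \<epsilon> = (\<lambda>x. \<phi> ((x - x0) / \<epsilon>) / \<epsilon>)"

definition has_Lojasiewicz_value :: "((real \<Rightarrow> real) \<Rightarrow> real) \<Rightarrow> real \<Rightarrow> real \<Rightarrow> bool" where
  "has_Lojasiewicz_value T x0 L \<longleftrightarrow>
     (\<forall>\<phi>\<in>test_functions.
        ((\<lambda>\<epsilon>. T (rescaled \<phi> x0 \<epsilon>)) \<longlongrightarrow> L * (LINT u|lebesgue. \<phi> u)) (at_right 0))"

text \<open>
  Since the Bochner integral of a non-integrable function is \<open>0\<close> by convention, integrability of
  the difference quotients near \<open>0\<close> has to be part of the following two definitions.
\<close>

definition has_SBD1 :: "(real \<Rightarrow> real) \<Rightarrow> real \<Rightarrow> real \<Rightarrow> bool" where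
  "has_SBD1 f x0 L \<longleftrightarrow>
     (\<forall>\<^sub>F h in at_right 0. (\<lambda>t. (f (x0 + t) - f (x0 - t)) / (2 * t)) absolutely_integrable_on {0<..h}) \<and>
     ((\<lambda>h. 1 / h * (LINT t:{0<..h}|lebesgue. (f (x0 + t) - f (x0 - t)) / (2 * t))) \<longlongrightarrow> L) (at_right 0)"

definition has_SBD2 :: "(real \<Rightarrow> real) \<Rightarrow> real \<Rightarrow> real \<Rightarrow> bool" where
  "has_SBD2 f x0 L \<longleftrightarrow>
     (\<forall>\<^sub>F h in at_right 0. (\<lambda>t. (f (x0 + t) + f (x0 - t) - 2 * f x0) / t\<^sup>2) absolutely_integrable_on {0<..h}) \<and>
     ((\<lambda>h. 1 / h * (LINT t:{0<..h}|lebesgue. (f (x0 + t) + f (x0 - t) - 2 * f x0) / t\<^sup>2)) \<longlongrightarrow> L) (at_right 0)"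

definition heaviside :: "real \<Rightarrow> real" where
  "heaviside x = (if x < 0 then 0 else 1)"

end

theory Submission
  imports Defs "HOL-Computational_Algebra.Polynomial"
begin

text \<open>
  A distributional point value tests \<open>T\<^sub>f'' = 2H\<close> with kernels that need not be even. A bump
  supported in \<open>[0, 1]\<close> forces the value \<open>2\<close> at \<open>0\<close>, its mirror image forces the value \<open>0\<close>. The
  second symmetric Borel derivative only sees \<open>f(t) + f(-t) = t\<^sup>2\<close>, where the jump of \<open>2H\<close> is averaged.
\<close>

section \<open>Test functions\<close>

text \<open>Smoothness without a formula for the iterated derivatives: it suffices to find a class
  \<open>S\<close> of differentiable functions that contains \<open>\<psi>\<close> and is closed
  under \<open>deriv\<close>.\<close>

lemma funpow_deriv_differentiable_coinduct:
  fixes \<psi> :: "real \<Rightarrow> real"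
  assumes "\<psi> \<in> S"
    and "\<And>g. g \<in> S \<Longrightarrow> g differentiable_on UNIV"
    and "\<And>g. g \<in> S \<Longrightarrow> deriv g \<in> S"
  shows "(deriv ^^ n) \<psi> differentiable_on UNIV"
proof -
  have "(deriv ^^ n) \<psi> \<in> S"
    by (induction n) (use assms in auto)
  with assms show ?thesis by blast
qed

lemma test_function_DERIV:
  assumes "\<psi> \<in> test_functions"
  shows "(\<psi> has_real_derivative deriv \<psi> x) (at x)"
proof -
  have "(deriv ^^ 0) \<psi> differentiable_on UNIV"
    using assms unfolding test_functions_def by blast
  then have "\<psi> field_differentiable at x"
    by (simp add: differentiable_on_def field_differentiable_def real_differentiable_def)
  then show ?thesis
    by (simp add: DERIV_deriv_iff_field_differentiable)
qed

lemma test_function_continuous: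
  assumes "\<psi> \<in> test_functions"
  shows "continuous_on A \<psi>"
  by (rule DERIV_continuous_on)
    (use test_function_DERIV[OF assms] has_field_derivative_at_within in blast)

lemma test_function_support:
  assumes "\<psi> \<in> test_functions"
  obtains R where "R > 0" and "\<And>x. \<bar>x\<bar> > R \<Longrightarrow> \<psi> x = 0"
proof -
  have "bounded (closure {x. \<psi> x \<noteq> 0})"
    using assms compact_imp_bounded unfolding test_functions_def by blast
  then obtain R where "R > 0" and R: "\<And>x. x \<in> closure {x. \<psi> x \<noteq> 0} \<Longrightarrow> norm x \<le> R"
    by (auto simp: bounded_pos)
  moreover have "\<psi> x = 0" if "\<bar>x\<bar> > R" for x
    using R[of x] that closure_subset[of "{x. \<psi> x \<noteq> 0}"] by force
  ultimately show ?thesis using that by blast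
qed

lemma test_functionI:
  assumes "\<And>n. (deriv ^^ n) \<psi> differentiable_on UNIV"
    and "\<And>x. \<bar>x\<bar> > R \<Longrightarrow> \<psi> x = 0"
  shows "\<psi> \<in> test_functions"
proof -
  have "{x. \<psi> x \<noteq> 0} \<subseteq> cball 0 R"
    using assms(2) by (force simp: not_less[symmetric])
  then have "bounded {x. \<psi> x \<noteq> 0}"
    using bounded_cball bounded_subset by blast
  with assms(1) show ?thesis
    by (auto simp: test_functions_def)
qed

lemma deriv_test_function:
  assumes "\<psi> \<in> test_functions"
  shows "deriv \<psi> \<in> test_functions"
proof -
  obtain R where R: "\<And>x. \<bar>x\<bar> > R \<Longrightarrow> \<psi> x = 0"
    using test_function_support[OF assms] by blast
  show ?thesis
  proof (rule test_functionI)
    fix n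
    have "(deriv ^^ Suc n) \<psi> differentiable_on UNIV"
      using assms unfolding test_functions_def by blast
    then show "(deriv ^^ n) (deriv \<psi>) differentiable_on UNIV"
      by (simp add: funpow_swap1)
  next
    fix x :: real
    assume "\<bar>x\<bar> > R"
    \<comment> \<open>The exterior is open, so \<open>\<psi>\<close> vanishes on a whole
      neighbourhood of \<open>x\<close>, and its derivative is that of the zero function.\<close>
    moreover have "open {x :: real. \<bar>x\<bar> > R}"
      by (intro open_Collect_less continuous_intros)
    ultimately have "\<forall>\<^sub>F y in nhds x. \<psi> y = 0"
      using R unfolding eventually_nhds by blast
    then have "deriv \<psi> x = deriv (\<lambda>y. 0) x"
      by (rule deriv_cong_ev) simp
    then show "deriv \<psi> x = 0" by simp
  qed
qed

text \<open>Covers both the rescalings in the definition of the point value and the reflection used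
  for the mirror-image bump.\<close>

lemma test_function_affine:
  assumes "\<psi> \<in> test_functions" and "c \<noteq> 0"
  shows "(\<lambda>x. a * \<psi> (c * x + d)) \<in> test_functions"
proof -
  obtain R where R: "\<And>x. \<bar>x\<bar> > R \<Longrightarrow> \<psi> x = 0"
    using test_function_support[OF assms(1)] by blast
  \<comment> \<open>The factor \<open>b\<close> varies because each application of the chain rule
    contributes another factor \<open>c\<close>; the inner affine map stays fixed.\<close>
  define S where "S = (\<lambda>(b, g). \<lambda>x. b * g (c * x + d)) ` (UNIV \<times> test_functions)"
  have der: "((\<lambda>x. b * g (c * x + d)) has_real_derivative b * c * deriv g (c * x + d)) (at x)"
    if "g \<in> test_functions" for b g x
    by (rule derivative_eq_intros DERIV_chain2[OF test_function_DERIV[OF that]] refl)+ simp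
  show ?thesis
  proof (rule test_functionI)
    show "(deriv ^^ n) (\<lambda>x. a * \<psi> (c * x + d)) differentiable_on UNIV" for n
    proof (rule funpow_deriv_differentiable_coinduct)
      show "(\<lambda>x. a * \<psi> (c * x + d)) \<in> S"
        using assms(1) by (auto simp: S_def)
    next
      fix g assume "g \<in> S"
      then obtain b k where g: "g = (\<lambda>x. b * k (c * x + d))" and k: "k \<in> test_functions"
        by (auto simp: S_def)
      show "g differentiable_on UNIV"
        using der[OF k] unfolding g differentiable_on_def real_differentiable_def by blast
      have "deriv g = (\<lambda>x. (b * c) * deriv k (c * x + d))"
        unfolding g by (rule ext) (rule DERIV_imp_deriv[OF der[OF k]])
      then show "deriv g \<in> S"
        using deriv_test_function[OF k] by (auto simp: S_def)
    qed
  next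
    fix x assume x: "\<bar>x\<bar> > (\<bar>R\<bar> + \<bar>d\<bar>) / \<bar>c\<bar>"
    then have "\<bar>R\<bar> + \<bar>d\<bar> < \<bar>c * x\<bar>"
      using assms(2) by (simp add: field_simps abs_mult)
    then have "\<bar>c * x + d\<bar> > R" by linarith
    then show "a * \<psi> (c * x + d) = 0" using R by simp
  qed
qed

lemma rescaled_test_function:
  assumes "\<phi> \<in> test_functions" and "\<epsilon> > 0"
  shows "rescaled \<phi> x0 \<epsilon> \<in> test_functions"
proof -
  have "rescaled \<phi> x0 \<epsilon> = (\<lambda>x. 1 / \<epsilon> * \<phi> (1 / \<epsilon> * x + - x0 / \<epsilon>))"
    by (simp add: rescaled_def diff_divide_distrib fun_eq_iff)
  also have "\<dots> \<in> test_functions"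
    by (rule test_function_affine[OF assms(1)]) (use assms(2) in simp)
  finally show ?thesis .
qed

section \<open>Integrals of test functions\<close>

lemma integrable_continuous_bounded_support:
  fixes g :: "real \<Rightarrow> real"
  assumes "continuous_on UNIV g" and "\<And>x. \<bar>x\<bar> > R \<Longrightarrow> g x = 0"
  shows "integrable lebesgue g"
proof -
  have "g absolutely_integrable_on {-R..R}"
    using absolutely_integrable_continuous_real assms(1) continuous_on_subset by blast
  moreover have "(\<lambda>x. indicator {-R..R} x *\<^sub>R g x) = g"
    using assms(2) by (force simp: indicator_def fun_eq_iff abs_le_iff not_less[symmetric])
  ultimately show ?thesis by (simp add: set_integrable_def)
qed

lemma integrable_test_function:
  assumes "\<psi> \<in> test_functions"
  shows "integrable lebesgue \<psi>"
  using test_function_support[OF assms] test_function_continuous[OF assms]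
    integrable_continuous_bounded_support by metis

lemma integral_test_function_affine:
  assumes "\<psi> \<in> test_functions" and "c \<noteq> 0"
  shows "(LINT x|lebesgue. \<psi> (c * x)) = (LINT x|lebesgue. \<psi> x) / \<bar>c\<bar>"
proof -
  \<comment> \<open>The substitution rule is stated for \<open>lborel\<close>; Borel measurability
    lets \<open>integral_completion\<close> carry it over to \<open>lebesgue\<close>.\<close>
  have "\<psi> \<in> borel_measurable borel"
    using assms(1) test_function_continuous borel_measurable_continuous_onI by blast
  then have "\<psi> \<in> borel_measurable lborel" "(\<lambda>x. \<psi> (c * x)) \<in> borel_measurable lborel"
    by measurable
  then show ?thesis
    using lborel_integral_real_affine[OF assms(2), of \<psi> 0] assms(2)
    by (simp add: integral_completion)
qed

section \<open>A one-sided bump function\<close>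

text \<open>Cauchy's flat function, with an index \<open>j\<close> for the powers of
  \<open>1 / y\<close> that differentiation produces.\<close>

definition exp_flat :: "nat \<Rightarrow> real \<Rightarrow> real" where
  "exp_flat j y = (if y > 0 then exp (- (1 / y)) / y ^ j else 0)"

text \<open>Brings terms of different index to a common one; for \<open>y \<le> 0\<close> both sides
  are zero.\<close>

lemma exp_flat_shift: "exp_flat j y = y ^ i * exp_flat (j + i) y"
  by (simp add: exp_flat_def power_add)

lemma exp_flat_tendsto_0: "(exp_flat j \<longlongrightarrow> 0) (at 0)"
  unfolding filterlim_at_split
proof
  show "(exp_flat j \<longlongrightarrow> 0) (at_left 0)"
    by (rule tendsto_eventually) (auto simp: exp_flat_def eventually_at_left_field intro: exI[of _ "-1"])
  \<comment> \<open>With \<open>s = 1 / y\<close> tending to infinity, the claim is that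
    \<open>exp s\<close> outgrows \<open>s ^ j\<close>.\<close>
  have "((\<lambda>y. inverse y ^ j / exp (inverse y)) \<longlongrightarrow> (0 :: real)) (at_right 0)"
    by (rule filterlim_compose[OF tendsto_power_div_exp_0 filterlim_inverse_at_top_right])
  moreover have "\<forall>\<^sub>F y in at_right 0. inverse y ^ j / exp (inverse y) = exp_flat j y"
    by (auto simp: eventually_at_right_field exp_flat_def exp_minus field_simps intro: exI[of _ 1])
  ultimately show "(exp_flat j \<longlongrightarrow> 0) (at_right 0)"
    by (rule Lim_transform_eventually)
qed

lemma exp_flat_DERIV:
  "(exp_flat j has_real_derivative exp_flat (j + 2) y - j * exp_flat (j + 1) y) (at y)"
proof (cases y "0 :: real" rule: linorder_cases)
  case less
  have "(exp_flat j has_real_derivative 0) (at y)"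
    by (rule has_field_derivative_transform_within_open[of "\<lambda>_. 0" _ _ "{..<0}"])
      (use less in \<open>auto simp: exp_flat_def\<close>)
  with less show ?thesis by (simp add: exp_flat_def)
next
  case equal
  \<comment> \<open>The difference quotient at 0 is \<open>exp_flat (j + 1)\<close>, so the limit
    already proved gives derivative 0.\<close>
  have "((\<lambda>h. exp_flat j h / h) \<longlongrightarrow> 0) (at 0)"
    by (rule Lim_transform_eventually[OF exp_flat_tendsto_0[of "j + 1"]])
      (auto simp: eventually_at exp_flat_shift[of j _ 1] intro: exI[of _ 1])
  with equal show ?thesis by (simp add: DERIV_def exp_flat_def)
next
  case greater
  have "((\<lambda>y. exp (- (1 / y)) / y ^ j) has_real_derivative
          (exp (- (1 / y)) * (1 / y\<^sup>2) * y ^ j - exp (- (1 / y)) * (j * y ^ (j - 1))) / (y ^ j * y ^ j)) (at y)"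
    using greater by (auto intro!: derivative_eq_intros simp: power2_eq_square)
  also have "(exp (- (1 / y)) * (1 / y\<^sup>2) * y ^ j - exp (- (1 / y)) * (j * y ^ (j - 1))) / (y ^ j * y ^ j) =
      exp_flat (j + 2) y - j * exp_flat (j + 1) y"
    \<comment> \<open>The split deals with \<open>y ^ (j - 1)\<close>: subtraction on naturals
      truncates at \<open>j = 0\<close>, where the factor \<open>j\<close> kills the term.\<close>
    using greater by (cases j) (auto simp: exp_flat_def field_simps power2_eq_square)
  finally show ?thesis
    by (rule has_field_derivative_transform_within_open[of _ _ _ "{0<..}"])
      (use greater in \<open>auto simp: exp_flat_def\<close>)
qed

text \<open>
  Since \<open>exp_flat j y = y\<^sup>2 * exp_flat (j + 2) y\<close>, the derivative is again a single product
  \<open>u * exp_flat j v\<close> with the same \<open>v\<close>, so that no sums are needed for a class closed under \<open>deriv\<close>.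
\<close>

lemma exp_flat_poly_smooth:
  "(deriv ^^ n) (\<lambda>x. poly u x * exp_flat j (poly v x)) differentiable_on UNIV"
proof -
  define S where "S = range (\<lambda>(u, j). \<lambda>x. poly u x * exp_flat j (poly v x))"
  \<comment> \<open>The product rule gives
    \<open>u' * e_j + u * v' * (e_(j+2) - j * e_(j+1))\<close>, with \<open>e_i\<close> for
    \<open>exp_flat i\<close> at \<open>v\<close>; \<open>D u j\<close> is what remains after
    factoring out \<open>e_(j+2)\<close>.\<close>
  define D where "D u j = pderiv u * v ^ 2 + u * pderiv v * (1 - of_nat j * v)" for u and j :: nat
  have der: "((\<lambda>x. poly u x * exp_flat j (poly v x)) has_real_derivative
               poly (D u j) x * exp_flat (j + 2) (poly v x)) (at x)" for u j x
    by (rule derivative_eq_intros DERIV_chain2[OF exp_flat_DERIV] poly_DERIV refl)+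
      (simp add: D_def exp_flat_shift[of j _ 2] exp_flat_shift[of "Suc j" _ 1] algebra_simps)
  show ?thesis
  proof (rule funpow_deriv_differentiable_coinduct)
    show "(\<lambda>x. poly u x * exp_flat j (poly v x)) \<in> S"
      by (auto simp: S_def)
  next
    fix g assume "g \<in> S"
    then obtain u j where g: "g = (\<lambda>x. poly u x * exp_flat j (poly v x))"
      by (auto simp: S_def)
    show "g differentiable_on UNIV"
      using der unfolding g differentiable_on_def real_differentiable_def by blast
    have "deriv g = (\<lambda>x. poly (D u j) x * exp_flat (j + 2) (poly v x))"
      unfolding g by (rule ext) (rule DERIV_imp_deriv[OF der])
    then show "deriv g \<in> S"
      by (auto simp: S_def)
  qed
qed

text \<open>The bump is \<open>exp (- 1 / (x * (1 - x)))\<close> on the open unit interval. It is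
  continuous and nonnegative, so a zero integral would make it vanish on \<open>[0, 1]\<close>,
  which fails at \<open>1 / 2\<close>.\<close>

lemma one_sided_bump_exists:
  obtains \<phi> where "\<phi> \<in> test_functions" and "\<And>x. x \<le> 0 \<Longrightarrow> \<phi> x = 0"
    and "(LINT x|lebesgue. \<phi> x) \<noteq> 0"
proof -
  define \<phi> where "\<phi> x = exp_flat 0 (x * (1 - x))" for x
  have zero: "\<phi> x = 0" if "x \<le> 0 \<or> x \<ge> 1" for x
    using that by (auto simp: \<phi>_def exp_flat_def zero_less_mult_iff)
  have "(deriv ^^ n) \<phi> differentiable_on UNIV" for n
    using exp_flat_poly_smooth[of n 1 0 "[:0, 1, -1:]"] by (simp add: \<phi>_def[abs_def] algebra_simps)
  then have test: "\<phi> \<in> test_functions"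
    by (rule test_functionI[of _ 1]) (intro zero, linarith)
  have nonneg: "\<phi> x \<ge> 0" for x
    by (simp add: \<phi>_def exp_flat_def)
  have "(LINT x|lebesgue. \<phi> x) \<noteq> 0"
  proof
    assume "(LINT x|lebesgue. \<phi> x) = 0"
    then have "(\<phi> has_integral 0) UNIV"
      using has_integral_integral_lebesgue[OF integrable_test_function[OF test]] by simp
    then have "((\<lambda>x. if x \<in> {0..1} then \<phi> x else 0) has_integral 0) UNIV"
      by (rule has_integral_eq[rotated]) (use zero in auto)
    then have "(\<phi> has_integral 0) (cbox 0 1)"
      by (simp only: has_integral_restrict_UNIV cbox_interval)
    then have "\<phi> (1 / 2) = 0"
      by (intro has_integral_0_cbox_imp_0[of 0 1 \<phi>] test_function_continuous[OF test] nonneg) auto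
    then show False by (simp add: \<phi>_def exp_flat_def)
  qed
  with test zero show ?thesis using that by blast
qed

section \<open>The function \<open>x\<^sub>+\<^sup>2\<close>\<close>

lemma continuous_imp_locally_integrable:
  assumes "continuous_on UNIV f"
  shows "locally_integrable f"
  unfolding locally_integrable_def
proof (intro allI impI)
  fix K :: "real set"
  assume K: "compact K"
  then obtain a b where "K \<subseteq> cbox a b"
    using bounded_subset_cbox_symmetric compact_imp_bounded by metis
  moreover have "f absolutely_integrable_on cbox a b"
    by (rule absolutely_integrable_continuous) (use assms continuous_on_subset in blast)
  moreover have "K \<in> sets lebesgue"
    using K by (simp add: compact_imp_closed)
  ultimately show "f absolutely_integrable_on K"
    using set_integrable_subset by blast
qed

text \<open>Two integrations by parts done at once: \<open>x^2 * \<psi>' - 2 * x * \<psi>\<close> is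
  a primitive of \<open>x^2 * \<psi>'' - 2 * \<psi>\<close>, and it vanishes at both ends of
  \<open>[0, R]\<close>.\<close>

lemma pos_part_square_deriv2:
  "distribution_eq (distribution_deriv2 (regular_distribution (\<lambda>x. (max x 0)\<^sup>2)))
     (regular_distribution (\<lambda>x. 2 * heaviside x))"
  unfolding distribution_eq_def distribution_deriv2_def regular_distribution_def
proof
  fix \<psi> assume \<psi>: "\<psi> \<in> test_functions"
  note \<psi>' = deriv_test_function[OF \<psi>]
  note \<psi>'' = deriv_test_function[OF \<psi>']
  obtain R0 where R0: "R0 > 0" "\<And>x. \<bar>x\<bar> > R0 \<Longrightarrow> \<psi> x = 0"
    using test_function_support[OF \<psi>] by blast
  obtain R1 where R1: "\<And>x. \<bar>x\<bar> > R1 \<Longrightarrow> deriv \<psi> x = 0"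
    using test_function_support[OF \<psi>'] by blast
  obtain R2 where R2: "\<And>x. \<bar>x\<bar> > R2 \<Longrightarrow> deriv (deriv \<psi>) x = 0"
    using test_function_support[OF \<psi>''] by blast
  \<comment> \<open>The \<open>+ 1\<close> turns vanishing for \<open>\<bar>x\<bar> > R\<close> into
    vanishing for \<open>\<bar>x\<bar> \<ge> R\<close>, so the boundary terms at \<open>R\<close>
    itself are zero.\<close>
  define R where "R = Max {R0, R1, R2} + 1"
  have R: "R > 0" "\<And>x. \<bar>x\<bar> \<ge> R \<Longrightarrow> \<psi> x = 0" "\<And>x. \<bar>x\<bar> \<ge> R \<Longrightarrow> deriv \<psi> x = 0"
    "\<And>x. \<bar>x\<bar> \<ge> R \<Longrightarrow> deriv (deriv \<psi>) x = 0"
    using R0 R1 R2 by (auto simp: R_def)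
  define g where "g x = x\<^sup>2 * deriv (deriv \<psi>) x - 2 * \<psi> x" for x
  have "(g has_integral (R\<^sup>2 * deriv \<psi> R - 2 * R * \<psi> R) - (0\<^sup>2 * deriv \<psi> 0 - 2 * 0 * \<psi> 0)) {0..R}"
  proof (rule fundamental_theorem_of_calculus)
    fix x
    have "((\<lambda>x. x\<^sup>2 * deriv \<psi> x - 2 * x * \<psi> x) has_real_derivative g x) (at x)"
      by (rule derivative_eq_intros test_function_DERIV[OF \<psi>] test_function_DERIV[OF \<psi>'] refl)+
        (simp add: g_def)
    then show "((\<lambda>x. x\<^sup>2 * deriv \<psi> x - 2 * x * \<psi> x) has_vector_derivative g x) (at x within {0..R})"
      by (simp add: has_real_derivative_iff_has_vector_derivative has_vector_derivative_at_within)
  qed (use R in simp)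
  then have "((\<lambda>x. if x \<in> {0..R} then g x else 0) has_integral 0) UNIV"
    using R by (simp only: has_integral_restrict_UNIV) simp
  \<comment> \<open>This holds at every point: at 0 both sides are \<open>- 2 * \<psi> 0\<close>,
    since \<open>heaviside 0 = 1\<close>.\<close>
  moreover have "(if x \<in> {0..R} then g x else 0) =
      (max x 0)\<^sup>2 * deriv (deriv \<psi>) x - 2 * heaviside x * \<psi> x" for x
    using R by (auto simp: g_def heaviside_def max_def)
  ultimately have "((\<lambda>x. (max x 0)\<^sup>2 * deriv (deriv \<psi>) x - 2 * heaviside x * \<psi> x) has_integral 0) UNIV"
    by simp
  moreover have int: "integrable lebesgue (\<lambda>x. (max x 0)\<^sup>2 * deriv (deriv \<psi>) x)"
    by (rule integrable_continuous_bounded_support[of _ R])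
      (use R in \<open>auto intro!: continuous_intros test_function_continuous[OF \<psi>'']\<close>)
  moreover have int': "integrable lebesgue (\<lambda>x. 2 * heaviside x * \<psi> x)"
  proof -
    have "integrable lebesgue (\<lambda>x. indicator {0..} x *\<^sub>R (2 * \<psi> x))"
      using integrable_test_function[OF \<psi>] by (intro integrable_mult_indicator) auto
    moreover have "(\<lambda>x. indicator {0..} x *\<^sub>R (2 * \<psi> x)) = (\<lambda>x. 2 * heaviside x * \<psi> x)"
      by (auto simp: heaviside_def)
    ultimately show ?thesis by simp
  qed
  ultimately have "(LINT x|lebesgue. (max x 0)\<^sup>2 * deriv (deriv \<psi>) x - 2 * heaviside x * \<psi> x) = 0"
    using has_integral_integral_lebesgue[OF Bochner_Integration.integrable_diff[OF int int']]
      has_integral_unique by blast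
  then show "(LINT x|lebesgue. (max x 0)\<^sup>2 * deriv (deriv \<psi>) x) = (LINT x|lebesgue. 2 * heaviside x * \<psi> x)"
    using int int' by simp
qed

text \<open>Rescalings with \<open>\<epsilon> > 0\<close> are test functions, so agreement with
  \<open>2H\<close> on \<open>test_functions\<close> already determines every value entering the
  limit.\<close>

lemma no_Lojasiewicz_value_heaviside:
  assumes "distribution_eq T (regular_distribution (\<lambda>x. 2 * heaviside x))"
  shows "\<not> has_Lojasiewicz_value T 0 L"
proof
  assume L: "has_Lojasiewicz_value T 0 L"
  obtain \<phi> where \<phi>: "\<phi> \<in> test_functions" and zero: "\<And>x. x \<le> 0 \<Longrightarrow> \<phi> x = 0"
    and nz: "(LINT x|lebesgue. \<phi> x) \<noteq> 0"
    using one_sided_bump_exists by blast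
  define I where "I = (LINT x|lebesgue. \<phi> x)"
  \<comment> \<open>For a bump on one side of 0 the pairing does not depend on
    \<open>\<epsilon>\<close>, so uniqueness of limits turns the point value into an equation for
    \<open>L\<close>.\<close>
  have eq: "L * (LINT x|lebesgue. \<psi> x) = c"
    if \<psi>: "\<psi> \<in> test_functions"
      and c: "\<And>\<epsilon>. \<epsilon> > 0 \<Longrightarrow> regular_distribution (\<lambda>x. 2 * heaviside x) (rescaled \<psi> 0 \<epsilon>) = c"
    for \<psi> c
  proof -
    have "((\<lambda>\<epsilon>. T (rescaled \<psi> 0 \<epsilon>)) \<longlongrightarrow> L * (LINT x|lebesgue. \<psi> x)) (at_right 0)"
      using L \<psi> by (simp add: has_Lojasiewicz_value_def)
    moreover have "T (rescaled \<psi> 0 \<epsilon>) = c" if "\<epsilon> > 0" for \<epsilon>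
      using assms c rescaled_test_function[OF \<psi>] that by (simp add: distribution_eq_def)
    then have "((\<lambda>\<epsilon>. T (rescaled \<psi> 0 \<epsilon>)) \<longlongrightarrow> c) (at_right 0)"
      by (intro tendsto_eventually) (auto simp: eventually_at_right_field intro: exI[of _ 1])
    ultimately show ?thesis
      using tendsto_unique trivial_limit_at_right_real by blast
  qed
  have "L * I = 2 * I"
    unfolding I_def
  proof (rule eq[OF \<phi>])
    fix \<epsilon> :: real assume "\<epsilon> > 0"
    \<comment> \<open>The bump vanishes wherever \<open>heaviside\<close> does, so only the factor 2
      survives.\<close>
    then have "2 * heaviside x * rescaled \<phi> 0 \<epsilon> x = 2 / \<epsilon> * \<phi> (1 / \<epsilon> * x)" for x
      using zero[of "x / \<epsilon>"] by (auto simp: heaviside_def rescaled_def divide_le_0_iff)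
    then show "regular_distribution (\<lambda>x. 2 * heaviside x) (rescaled \<phi> 0 \<epsilon>) = 2 * (LINT x|lebesgue. \<phi> x)"
      using \<open>\<epsilon> > 0\<close> integral_test_function_affine[OF \<phi>, of "1 / \<epsilon>"]
      by (simp add: regular_distribution_def)
  qed
  moreover have "L * I = 0"
  proof -
    have "L * (LINT x|lebesgue. \<phi> (- 1 * x)) = 0"
    proof (rule eq)
      show "(\<lambda>x. \<phi> (- 1 * x)) \<in> test_functions"
        using test_function_affine[OF \<phi>, of "-1" 1 0] by simp
      fix \<epsilon> :: real assume "\<epsilon> > 0"
      \<comment> \<open>The reflected bump vanishes for \<open>x \<ge> 0\<close>, including
        \<open>x = 0\<close>, where \<open>heaviside\<close> is 1.\<close>
      then have "2 * heaviside x * rescaled (\<lambda>x. \<phi> (- 1 * x)) 0 \<epsilon> x = 0" for x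
        using zero[of "- x / \<epsilon>"] by (auto simp: heaviside_def rescaled_def)
      then show "regular_distribution (\<lambda>x. 2 * heaviside x) (rescaled (\<lambda>x. \<phi> (- 1 * x)) 0 \<epsilon>) = 0"
        by (simp only: regular_distribution_def) simp
    qed
    then show ?thesis
      using integral_test_function_affine[OF \<phi>, of "-1"] by (simp add: I_def)
  qed
  ultimately show False using nz by (simp add: I_def)
qed

section \<open>Symmetric Borel derivatives at 0\<close>

lemma pos_part_square_SBD1: "has_SBD1 (\<lambda>x. (max x 0)\<^sup>2) 0 0"
proof -
  \<comment> \<open>For \<open>t > 0\<close> only the right branch contributes; the mean of
    \<open>t / 2\<close> over \<open>(0, h]\<close> is \<open>h / 4\<close>, which tends to
    0.\<close>
  have eq: "((max (0 + t) 0)\<^sup>2 - (max (0 - t) 0)\<^sup>2) / (2 * t) = t / 2" if "t \<in> {0<..h}" for t h :: real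
    using that by (simp add: power2_eq_square)
  have abs: "(\<lambda>t. t / 2) absolutely_integrable_on {0<..h}" for h :: real
    by (rule set_integrable_subset[of _ "{0..h}"])
      (auto intro!: absolutely_integrable_continuous_real continuous_intros)
  have val: "(LINT t:{0<..h}|lebesgue. t / 2) = h\<^sup>2 / 4" if "h > 0" for h :: real
  proof -
    have "((\<lambda>t. t / 2) has_integral h\<^sup>2 / 4 - 0\<^sup>2 / 4) {0..h}"
      by (rule fundamental_theorem_of_calculus)
        (use that in \<open>auto intro!: derivative_eq_intros
          simp: has_real_derivative_iff_has_vector_derivative[symmetric]\<close>)
    \<comment> \<open>The two intervals differ only in the null set \<open>{0}\<close>.\<close>
    then have "((\<lambda>t. t / 2) has_integral h\<^sup>2 / 4) {0<..h}"
      by (subst has_integral_spike_set_eq[where T = "{0..h}"])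
        (auto intro: negligible_subset[of "{0}"])
    then show ?thesis
      using set_lebesgue_integral_eq_integral(2)[OF abs] integral_unique by metis
  qed
  have "((\<lambda>h. h / 4) \<longlongrightarrow> (0 :: real)) (at_right 0)"
    by (auto intro!: tendsto_eq_intros)
  then have "((\<lambda>h. 1 / h * (LINT t:{0<..h}|lebesgue. t / 2)) \<longlongrightarrow> (0 :: real)) (at_right 0)"
    by (rule Lim_transform_eventually)
      (rule eventually_mono[OF eventually_at_right_less], subst val, auto simp: power2_eq_square)
  moreover have "(LINT t:{0<..h}|lebesgue. ((max (0 + t) 0)\<^sup>2 - (max (0 - t) 0)\<^sup>2) / (2 * t))
      = (LINT t:{0<..h}|lebesgue. t / 2)" for h :: real
    by (rule set_lebesgue_integral_cong) (use eq in auto)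
  moreover have "(\<lambda>t. ((max (0 + t) 0)\<^sup>2 - (max (0 - t) 0)\<^sup>2) / (2 * t)) absolutely_integrable_on {0<..h}"
    for h :: real
    using abs[of h] by (subst set_integrable_cong[OF refl refl eq]) auto
  ultimately show ?thesis by (simp only: has_SBD1_def eventually_True simp_thms)
qed

lemma pos_part_square_SBD2: "has_SBD2 (\<lambda>x. (max x 0)\<^sup>2) 0 1"
proof -
  \<comment> \<open>The second difference is exactly \<open>t^2\<close>, so every mean of the
    quotient equals 1, midway between the one-sided values 0 and 2 of \<open>2H\<close>.\<close>
  have eq: "((max (0 + t) 0)\<^sup>2 + (max (0 - t) 0)\<^sup>2 - 2 * (max 0 0)\<^sup>2) / t\<^sup>2 = 1"
    if "t \<in> {0<..h}" for t h :: real
    using that by simp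
  have abs: "(\<lambda>t. 1 :: real) absolutely_integrable_on {0<..h}" for h :: real
    by (rule set_integrable_subset[of _ "{0..h}"])
      (auto intro!: absolutely_integrable_continuous_real continuous_intros)
  have val: "(LINT t:{0<..h}|lebesgue. 1) = h" if "h > 0" for h :: real
    using that by (simp add: set_lebesgue_integral_def)
  have "((\<lambda>h. 1 / h * (LINT t:{0<..h}|lebesgue. 1)) \<longlongrightarrow> (1 :: real)) (at_right 0)"
    by (rule tendsto_eventually) (auto simp: eventually_at_right_field val intro: exI[of _ 1])
  moreover have "(LINT t:{0<..h}|lebesgue. ((max (0 + t) 0)\<^sup>2 + (max (0 - t) 0)\<^sup>2 - 2 * (max 0 0)\<^sup>2) / t\<^sup>2)
      = (LINT t:{0<..h}|lebesgue. 1)" for h :: real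
    by (rule set_lebesgue_integral_cong) (use eq in auto)
  moreover have "(\<lambda>t. ((max (0 + t) 0)\<^sup>2 + (max (0 - t) 0)\<^sup>2 - 2 * (max 0 0)\<^sup>2) / t\<^sup>2)
      absolutely_integrable_on {0<..h}" for h :: real
    using abs[of h] by (subst set_integrable_cong[OF refl refl eq]) auto
  ultimately show ?thesis by (simp add: has_SBD2_def)
qed

theorem proposition3p15:
  shows "\<not> (\<forall>(f :: real \<Rightarrow> real) x0.
            locally_integrable f \<and> (\<exists>L. has_SBD2 f x0 L) \<longrightarrow>
            (\<exists>L. has_Lojasiewicz_value (distribution_deriv2 (regular_distribution f)) x0 L))
    \<and> (let f = (\<lambda>x :: real. (max x 0)\<^sup>2) in
         locally_integrable f \<and>
         has_SBD1 f 0 0 \<and>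
         has_SBD2 f 0 1 \<and>
         distribution_eq (distribution_deriv2 (regular_distribution f))
                         (regular_distribution (\<lambda>x. 2 * heaviside x)) \<and>
         \<not> (\<exists>L. has_Lojasiewicz_value (distribution_deriv2 (regular_distribution f)) 0 L))"
proof -
  let ?f = "\<lambda>x :: real. (max x 0)\<^sup>2"
  have "locally_integrable ?f"
    by (intro continuous_imp_locally_integrable continuous_intros)
  moreover have "\<not> (\<exists>L. has_Lojasiewicz_value (distribution_deriv2 (regular_distribution ?f)) 0 L)"
    using no_Lojasiewicz_value_heaviside[OF pos_part_square_deriv2] by blast
  \<comment> \<open>The first conjunct is refuted by \<open>?f\<close> at \<open>x0 = 0\<close>,
    with 1 as its second symmetric Borel derivative.\<close>
  ultimately show ?thesis
    unfolding Let_def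
    using pos_part_square_SBD1 pos_part_square_SBD2 pos_part_square_deriv2 by blast
qed

end
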